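(* Let $k\ge 2$ be an integer (the leap stride). For a real number $\gamma>0$ (the attenuation coefficient), let $f_\gamma(i):=\exp[-\gamma\,(i-1)]$ for integers $i\ge 1$ be the probability decay function. For an integer $n\ge 1$ (the number of prediction heads) define the expected acceptance lengths $$\mathbb{E}[L]=\sum_{m=1}^{n}\ \prod_{i=1}^{m} f_\gamma(i),\qquad \mathbb{E}[L]_l=\sum_{m=1}^{k(n-1)+1}\ \prod_{i=1}^{m} f_\gamma\bigl(i+((i-1)\bmod k)\bigr),$$ where $(i-1)\bmod k\in\{0,1,\dots,k-1\}$ denotes the remainder of $i-1$ upon division by $k$. Then there exists a constant $C>0$ such that $\mathbb{E}[L]_l>\mathbb{E}[L]$ holds asymptotically as $n\to\infty$ provided that $\gamma n^2\le C$ (i.e. $\gamma=O(1/n^2)$). That is, there exist $C>0$ and an integer $N$ such that for all integers $n\ge N$ and all real $\gamma>0$ with $\gamma n^2\le C$ one has $\mathbb{E}[L]_l>\mathbb{E}[L]$.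
   Context: Origin of the quantities. A language model with $n$ output heads predicts several future tokens at once; $p(\mathrm{x}_{t+i}\mid \mathrm{x}_{\le t})$ is the marginal probability of the token $i$ steps ahead given the first $t$ tokens. The consistency assumption states that the expected marginal probability depends only on the prediction horizon: $\mathbb{E}_{\mathrm{x}_{\le t}\sim\mathcal{D}}[p(\mathrm{x}_{t+i}\mid \mathrm{x}_{\le t})]=f(i)$ for every position $t$, so that predicting $\mathrm{x}_{t+i}$ from $\mathrm{x}_{\le t-s}$ has expected probability $f(i+s)$. In the theorem, $f=f_\gamma$. The vanilla multi-token strategy predicts the $n$ adjacent tokens $\mathrm{x}_{t+1},\dots,\mathrm{x}_{t+n}$ from $\mathrm{x}_{\le t}$, and its expected accepted length is defined as $$\mathbb{E}[L]=\sum_{m=1}^{n}\prod_{i=1}^{m}\mathbb{E}_{\mathrm{x}_{\le t}\sim\mathcal{D}}[p(\mathrm{x}_{t+i}\mid \mathrm{x}_{\le t})].$$ The leap strategy (L-MTP) with stride $k$ predicts from $\mathrm{x}_{\le t}$ the tokens at positions $t+1,t+k+1,\dots,t+k(n-1)+1$, and fills the gaps with predictions made from earlier prefixes. Its expected accepted length is defined as $$\mathbb{E}[L]_l=\sum_{m=1}^{k(n-1)+1}\prod_{i=1}^{m}\mathbb{E}_{\mathrm{x}_{\le t}\sim\mathcal{D}}[p(\mathrm{x}_{t+i}\mid \mathrm{x}_{\le t-((i-1)\bmod k)})].$$ Under the consistency assumption with $f=f_\gamma$, these are exactly the two sums in the claim. The claim may be read purely as a statement about these sums. *)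

theory Defs
  imports Complex_Main
begin

definition decay :: "real \<Rightarrow> nat \<Rightarrow> real" where
  "decay \<gamma> i = exp (- \<gamma> * (real i - 1))"

text \<open>
  In both expected accepted lengths, \<open>f h\<close> is the expected marginal probability of the
  token \<open>h\<close> steps ahead of the prefix it is predicted from (\<open>h \<ge> 1\<close>).
\<close>

definition vanilla_length :: "(nat \<Rightarrow> real) \<Rightarrow> nat \<Rightarrow> real" where
  "vanilla_length f n = (\<Sum>m=1..n. \<Prod>i=1..m. f i)"

text \<open>
  With stride \<open>k\<close>, the token at position \<open>t + i\<close> is predicted from the prefix ending at
  \<open>t - ((i - 1) mod k)\<close>, hence at horizon \<open>i + ((i - 1) mod k)\<close>. The truncated
  subtractions agree with the integer ones for \<open>n \<ge> 1\<close>, the intended range.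
\<close>

definition leap_length :: "(nat \<Rightarrow> real) \<Rightarrow> nat \<Rightarrow> nat \<Rightarrow> real" where
  "leap_length f k n = (\<Sum>m=1..k * (n - 1) + 1. \<Prod>i=1..m. f (i + ((i - 1) mod k)))"

end

theory Submission
  imports Defs
begin

text \<open>
  Every factor is at most \<open>1\<close>, so the vanilla length is at most \<open>n\<close>. Since \<open>k \<ge> 2\<close>, the leap
  length has at least \<open>2n - 1\<close> positive summands; in the first \<open>2n - 1\<close> of them every horizon
  is at most \<open>4n\<close>, so each is at least \<open>exp (- 8 \<gamma> n\<^sup>2)\<close>. If \<open>\<gamma> n\<^sup>2 \<le> 1/32\<close> this is at least
  \<open>3/4\<close>, and \<open>3/4 \<cdot> (2n - 1) > n\<close> as soon as \<open>n \<ge> 2\<close>. The constant does not depend on \<open>k\<close>.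
\<close>

lemma decay_nonneg: "0 \<le> decay \<gamma> i"
  by (simp add: decay_def)

lemma decay_le_1: "decay \<gamma> i \<le> 1" if "0 \<le> \<gamma>" "1 \<le> i"
  using that by (simp add: decay_def)

lemma vanilla_length_decay_le: "vanilla_length (decay \<gamma>) n \<le> real n" if "0 \<le> \<gamma>"
proof -
  have "vanilla_length (decay \<gamma>) n \<le> (\<Sum>m=1..n. 1)"
    unfolding vanilla_length_def
    by (intro sum_mono prod_le_1) (auto simp: decay_nonneg decay_le_1 that)
  then show ?thesis by simp
qed

lemma leap_prod_decay_ge:
  assumes "0 \<le> \<gamma>" "m \<le> 2 * n"
  shows "exp (- 8 * \<gamma> * (real n)\<^sup>2) \<le> (\<Prod>i=1..m. decay \<gamma> (i + (i - 1) mod k))"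
proof -
  have factor: "exp (- \<gamma> * real (4 * n)) \<le> decay \<gamma> (i + (i - 1) mod k)" if "i \<in> {1..m}" for i
  proof -
    \<comment> \<open>Bounding the remainder by \<open>i - 1\<close> instead of \<open>k - 1\<close>
      keeps the estimate free of \<open>k\<close>.\<close>
    have "i + (i - 1) mod k \<le> 4 * n"
      using that \<open>m \<le> 2 * n\<close> mod_less_eq_dividend[of "i - 1" k]
      unfolding atLeastAtMost_iff by linarith
    then have "real (i + (i - 1) mod k) - 1 \<le> real (4 * n)" by linarith
    with \<open>0 \<le> \<gamma>\<close> show ?thesis
      unfolding decay_def exp_le_cancel_iff by (intro mult_left_mono_neg) auto
  qed
  \<comment> \<open>The 8 in the exponent is 2 * 4: at most \<open>2 * n\<close> factors, each
    costing at most \<open>\<gamma> * 4 * n\<close>.\<close>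
  have "real m * (\<gamma> * real (4 * n)) \<le> real (2 * n) * (\<gamma> * real (4 * n))"
    using assms by (intro mult_right_mono) (simp_all only: of_nat_le_iff, simp)
  then have "exp (- 8 * \<gamma> * (real n)\<^sup>2) \<le> exp (real m * (- \<gamma> * real (4 * n)))"
    by (simp add: power2_eq_square algebra_simps)
  also have "\<dots> = (\<Prod>i=1..m. exp (- \<gamma> * real (4 * n)))"
    by (simp only: exp_of_nat_mult prod_constant card_atLeastAtMost) simp
  also have "\<dots> \<le> (\<Prod>i=1..m. decay \<gamma> (i + (i - 1) mod k))"
    by (intro prod_mono) (use factor in auto)
  finally show ?thesis .
qed

lemma leap_length_decay_ge:
  assumes "2 \<le> k" "1 \<le> n" "0 \<le> \<gamma>"
  shows "(2 * real n - 1) * exp (- 8 * \<gamma> * (real n)\<^sup>2) \<le> leap_length (decay \<gamma>) k n"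
proof -
  have "2 * (n - 1) \<le> k * (n - 1)"
    using assms by (intro mult_right_mono) auto
  \<comment> \<open>For \<open>n \<ge> 1\<close>, \<open>2 * n - 1\<close> is
    \<open>2 * (n - 1) + 1\<close>, the number of summands at stride 2.\<close>
  then have sub: "{1..2 * n - 1} \<subseteq> {1..k * (n - 1) + 1}"
    unfolding atLeastatMost_subset_iff by linarith
  have "(2 * real n - 1) * exp (- 8 * \<gamma> * (real n)\<^sup>2)
      = (\<Sum>m=1..2 * n - 1. exp (- 8 * \<gamma> * (real n)\<^sup>2))"
    using assms by (simp add: of_nat_diff)
  also have "\<dots> \<le> (\<Sum>m=1..2 * n - 1. \<Prod>i=1..m. decay \<gamma> (i + (i - 1) mod k))"
    using assms by (intro sum_mono leap_prod_decay_ge) auto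
  also have "\<dots> \<le> leap_length (decay \<gamma>) k n"
    unfolding leap_length_def
    by (intro sum_mono2 sub) (auto intro: prod_nonneg decay_nonneg)
  finally show ?thesis .
qed

theorem theorem3:
  fixes k :: nat
  assumes "k \<ge> 2"
  shows "\<exists>C::real. C > 0 \<and> (\<exists>N::nat. N \<ge> 1 \<and> (\<forall>n::nat. \<forall>\<gamma>::real.
           n \<ge> N \<longrightarrow> \<gamma> > 0 \<longrightarrow> \<gamma> * (real n)\<^sup>2 \<le> C \<longrightarrow>
           leap_length (decay \<gamma>) k n > vanilla_length (decay \<gamma>) n))"
proof -
  have "vanilla_length (decay \<gamma>) n < leap_length (decay \<gamma>) k n"
    if n: "2 \<le> n" and \<gamma>: "0 < \<gamma>" "\<gamma> * (real n)\<^sup>2 \<le> 1 / 32" for n :: nat and \<gamma> :: real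
  proof -
    \<comment> \<open>From \<open>exp x \<ge> 1 + x\<close>: the constant 1/32 makes
      \<open>x \<ge> - 8 / 32 = - 1 / 4\<close>.\<close>
    have "3 / 4 \<le> exp (- 8 * \<gamma> * (real n)\<^sup>2)"
      using \<gamma> exp_ge_add_one_self[of "- 8 * \<gamma> * (real n)\<^sup>2"] by simp
    then have "(2 * real n - 1) * (3 / 4) \<le> (2 * real n - 1) * exp (- 8 * \<gamma> * (real n)\<^sup>2)"
      using n by (intro mult_left_mono) auto
    also have "\<dots> \<le> leap_length (decay \<gamma>) k n"
      using assms n \<gamma> by (intro leap_length_decay_ge) auto
    finally have "(2 * real n - 1) * (3 / 4) \<le> leap_length (decay \<gamma>) k n" .
    \<comment> \<open>Equivalent to \<open>n > 3 / 2\<close>, hence the threshold 2.\<close>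
    moreover have "real n < (2 * real n - 1) * (3 / 4)"
      using n by simp
    ultimately show ?thesis
      using vanilla_length_decay_le[of \<gamma> n] \<gamma> by linarith
  qed
  then show ?thesis
    by (intro exI[of _ "1 / 32"] conjI exI[of _ 2]) auto
qed

end
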